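(* Let $(M,P,g)$ be a Riemannian almost product $\mathcal{W}_3$-manifold whose canonical connection $\nabla'$ has parallel torsion $T$, i.e. $\nabla'T=0$. Let $\nabla$ be the Levi-Civita connection, $Q(x,y)=\nabla'_xy-\nabla_xy$, and let $R'$ and $R$ be the curvature tensors of $\nabla'$ and $\nabla$. Then for all $x,y,z,w$ \[ \begin{aligned} R'(x,y,z,w)=R(x,y,z,w)&+g(Q(y,z),Q(x,w))-g(Q(x,z),Q(y,w))\\ &+g(Q(z,w),T(x,y))-g\bigl((\nabla_{Pw}P)z,T(x,y)\bigr). \end{aligned} \]
   Context: A Riemannian almost product manifold $(M,P,g)$ is a differentiable manifold $M$ with a $(1,1)$-tensor field $P$ and a Riemannian metric $g$ such that $P^2x=x$ and $g(Px,Py)=g(x,y)$ for all vector fields $x,y$; throughout it is assumed that $\mathrm{tr}\,P=0$. Let $\nabla$ be the Levi-Civita connection of $g$ and $F(x,y,z)=g((\nabla_xP)y,z)$. $(M,P,g)$ is a Riemannian almost product $\mathcal{W}_3$-manifold if $F(x,y,z)+F(y,z,x)+F(z,x,y)=0$ for all $x,y,z$. A natural connection is a linear connection $\nabla'$ with $\nabla'P=0$ and $\nabla'g=0$; its torsion is $T(x,y)=\nabla'_xy-\nabla'_yx-[x,y]$, with $T(x,y,z)=g(T(x,y),z)$. The canonical connection is the natural connection whose torsion satisfies \[T(x,y,z)+T(y,z,x)+T(Px,y,Pz)+T(y,Pz,Px)=0\] for all $x,y,z$; it is known that it exists and is unique on every Riemannian almost product manifold. Curvature: $R(x,y)z=\nabla_x\nabla_yz-\nabla_y\nabla_xz-\nabla_{[x,y]}z$,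 $R(x,y,z,w)=g(R(x,y)z,w)$, and $R'$ is defined in the same way from $\nabla'$. *)

theory Defs
  imports "HOL-Analysis.Analysis" "HOL-Library.Function_Algebras"
begin

text \<open>
  Function spaces are real vector spaces under the pointwise operations. The additive and
  multiplicative structure comes from \<^theory>\<open>HOL-Library.Function_Algebras\<close>, so the
  expressions \<open>X + Y\<close>, \<open>X - Y\<close>, \<open>f * g\<close> on functions, tangent vectors and vector fields
  below are all pointwise.
\<close>

instantiation "fun" :: (type, real_vector) real_vector
begin

definition scaleR_fun :: "real \<Rightarrow> ('a \<Rightarrow> 'b) \<Rightarrow> 'a \<Rightarrow> 'b" where
  "scaleR_fun c f = (\<lambda>x. c *\<^sub>R f x)"

instance
  by standard (simp_all add: scaleR_fun_def fun_eq_iff scaleR_add_right scaleR_add_left)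

end

text \<open>Derivatives are not relativised to \<open>S\<close>, so these notions of smoothness on \<open>S\<close> are meant for open \<open>S\<close>.\<close>

primrec Ck_on :: "nat \<Rightarrow> 'e::real_normed_vector set \<Rightarrow> ('e \<Rightarrow> 'f::real_normed_vector) \<Rightarrow> bool" where
  "Ck_on 0 S f \<longleftrightarrow> continuous_on S f"
| "Ck_on (Suc k) S f \<longleftrightarrow>
     (\<forall>x\<in>S. f differentiable (at x)) \<and> (\<forall>v. Ck_on k S (\<lambda>x. frechet_derivative f (at x) v))"

definition Cinf_on :: "'e::real_normed_vector set \<Rightarrow> ('e \<Rightarrow> 'f::real_normed_vector) \<Rightarrow> bool" where
  "Cinf_on S f \<longleftrightarrow> (\<forall>k. Ck_on k S f)"

type_synonym ('a, 'e) chart = "'a set \<times> ('a \<Rightarrow> 'e)"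

text \<open>
  The underlying space of the manifold is the whole type \<open>'a\<close>, whose topology is Hausdorff and
  second countable, and the model space is the Euclidean space \<open>'e\<close>. The atlas need not be maximal.
\<close>

definition smooth_atlas ::
    "('a::{t2_space,second_countable_topology}, 'e::euclidean_space) chart set \<Rightarrow> bool" where
  "smooth_atlas A \<longleftrightarrow>
     (\<forall>(U, \<phi>)\<in>A. open U \<and> open (\<phi> ` U) \<and> homeomorphism U (\<phi> ` U) \<phi> (inv_into U \<phi>)) \<and>
     (\<Union>(U, \<phi>)\<in>A. U) = UNIV \<and>
     (\<forall>(U, \<phi>)\<in>A. \<forall>(V, \<psi>)\<in>A. Cinf_on (\<phi> ` (U \<inter> V)) (\<psi> \<circ> inv_into U \<phi>))"

definition smooth_funs :: "('a, 'e::euclidean_space) chart set \<Rightarrow> ('a \<Rightarrow> real) set" where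
  "smooth_funs A = {f. \<forall>(U, \<phi>)\<in>A. Cinf_on (\<phi> ` U) (f \<circ> inv_into U \<phi>)}"

text \<open>
  Tangent vectors at \<open>p\<close> are the derivations at \<open>p\<close> of the algebra of smooth functions, extended by
  zero to non-smooth functions so that equal tangent vectors are equal as HOL functions.
\<close>

type_synonym 'a tvec = "('a \<Rightarrow> real) \<Rightarrow> real"

definition tangent_space :: "('a, 'e::euclidean_space) chart set \<Rightarrow> 'a \<Rightarrow> 'a tvec set" where
  "tangent_space A p = {u.
     (\<forall>f\<in>smooth_funs A. \<forall>h\<in>smooth_funs A. u (f + h) = u f + u h) \<and>
     (\<forall>c. \<forall>f\<in>smooth_funs A. u (c *\<^sub>R f) = c * u f) \<and>
     (\<forall>f\<in>smooth_funs A. \<forall>h\<in>smooth_funs A. u (f * h) = f p * u h + h p * u f) \<and>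
     (\<forall>f. f \<notin> smooth_funs A \<longrightarrow> u f = 0)}"

type_synonym 'a vfield = "'a \<Rightarrow> 'a tvec"

definition lie_deriv :: "'a vfield \<Rightarrow> ('a \<Rightarrow> real) \<Rightarrow> 'a \<Rightarrow> real" where
  "lie_deriv X f = (\<lambda>p. X p f)"

definition vector_fields :: "('a, 'e::euclidean_space) chart set \<Rightarrow> 'a vfield set" where
  "vector_fields A = {X. (\<forall>p. X p \<in> tangent_space A p) \<and>
                         (\<forall>f\<in>smooth_funs A. lie_deriv X f \<in> smooth_funs A)}"

definition fmult :: "('a \<Rightarrow> real) \<Rightarrow> 'a vfield \<Rightarrow> 'a vfield" where
  "fmult f X = (\<lambda>p. f p *\<^sub>R X p)"

definition lie_bracket :: "'a vfield \<Rightarrow> 'a vfield \<Rightarrow> 'a vfield" where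
  "lie_bracket X Y = (\<lambda>p f. X p (lie_deriv Y f) - Y p (lie_deriv X f))"

text \<open>
  Tensor fields are families of (multi)linear maps on the tangent spaces; smoothness means that
  smooth vector fields are mapped to smooth vector fields, respectively smooth functions.
\<close>

definition app :: "('a \<Rightarrow> 'a tvec \<Rightarrow> 'a tvec) \<Rightarrow> 'a vfield \<Rightarrow> 'a vfield" where
  "app P X = (\<lambda>p. P p (X p))"

definition tensor_field_11 ::
    "('a, 'e::euclidean_space) chart set \<Rightarrow> ('a \<Rightarrow> 'a tvec \<Rightarrow> 'a tvec) \<Rightarrow> bool" where
  "tensor_field_11 A P \<longleftrightarrow>
     (\<forall>p. \<forall>u\<in>tangent_space A p. P p u \<in> tangent_space A p) \<and>
     (\<forall>p. \<forall>u\<in>tangent_space A p. \<forall>v\<in>tangent_space A p. P p (u + v) = P p u + P p v) \<and>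
     (\<forall>p c. \<forall>u\<in>tangent_space A p. P p (c *\<^sub>R u) = c *\<^sub>R P p u) \<and>
     (\<forall>X\<in>vector_fields A. app P X \<in> vector_fields A)"

type_synonym 'a metric = "'a \<Rightarrow> 'a tvec \<Rightarrow> 'a tvec \<Rightarrow> real"

definition ip :: "'a metric \<Rightarrow> 'a vfield \<Rightarrow> 'a vfield \<Rightarrow> 'a \<Rightarrow> real" where
  "ip g X Y = (\<lambda>p. g p (X p) (Y p))"

definition riemannian_metric :: "('a, 'e::euclidean_space) chart set \<Rightarrow> 'a metric \<Rightarrow> bool" where
  "riemannian_metric A g \<longleftrightarrow>
     (\<forall>p. \<forall>u\<in>tangent_space A p. \<forall>v\<in>tangent_space A p. g p u v = g p v u) \<and>
     (\<forall>p. \<forall>u\<in>tangent_space A p. \<forall>v\<in>tangent_space A p. \<forall>w\<in>tangent_space A p.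
        g p (u + v) w = g p u w + g p v w) \<and>
     (\<forall>p c. \<forall>u\<in>tangent_space A p. \<forall>v\<in>tangent_space A p. g p (c *\<^sub>R u) v = c * g p u v) \<and>
     (\<forall>p. \<forall>u\<in>tangent_space A p. u \<noteq> 0 \<longrightarrow> g p u u > 0) \<and>
     (\<forall>X\<in>vector_fields A. \<forall>Y\<in>vector_fields A. ip g X Y \<in> smooth_funs A)"

text \<open>Trace of an endomorphism \<open>L\<close> of a finite-dimensional subspace \<open>V\<close>, computed in some basis.\<close>

definition trace_on :: "'v::real_vector set \<Rightarrow> ('v \<Rightarrow> 'v) \<Rightarrow> real" where
  "trace_on V L = (let B = (SOME B. independent B \<and> span B = V)
                   in \<Sum>b\<in>B. representation B (L b) b)"

definition riemannian_almost_product_manifold ::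
    "('a::{t2_space,second_countable_topology}, 'e::euclidean_space) chart set \<Rightarrow>
     ('a \<Rightarrow> 'a tvec \<Rightarrow> 'a tvec) \<Rightarrow> 'a metric \<Rightarrow> bool" where
  "riemannian_almost_product_manifold A P g \<longleftrightarrow>
     smooth_atlas A \<and> tensor_field_11 A P \<and> riemannian_metric A g \<and>
     (\<forall>x\<in>vector_fields A. app P (app P x) = x) \<and>
     (\<forall>x\<in>vector_fields A. \<forall>y\<in>vector_fields A. ip g (app P x) (app P y) = ip g x y) \<and>
     (\<forall>p. trace_on (tangent_space A p) (P p) = 0)"

type_synonym 'a connection = "'a vfield \<Rightarrow> 'a vfield \<Rightarrow> 'a vfield"

definition linear_connection ::
    "('a, 'e::euclidean_space) chart set \<Rightarrow> 'a connection \<Rightarrow> bool" where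
  "linear_connection A D \<longleftrightarrow>
     (\<forall>x\<in>vector_fields A. \<forall>y\<in>vector_fields A. D x y \<in> vector_fields A) \<and>
     (\<forall>x\<in>vector_fields A. \<forall>y\<in>vector_fields A. \<forall>z\<in>vector_fields A.
        D (x + y) z = D x z + D y z \<and> D x (y + z) = D x y + D x z) \<and>
     (\<forall>f\<in>smooth_funs A. \<forall>x\<in>vector_fields A. \<forall>y\<in>vector_fields A.
        D (fmult f x) y = fmult f (D x y) \<and>
        D x (fmult f y) = fmult (lie_deriv x f) y + fmult f (D x y))"

definition metric_connection ::
    "('a, 'e::euclidean_space) chart set \<Rightarrow> 'a metric \<Rightarrow> 'a connection \<Rightarrow> bool" where
  "metric_connection A g D \<longleftrightarrow>
     (\<forall>x\<in>vector_fields A. \<forall>y\<in>vector_fields A. \<forall>z\<in>vector_fields A.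
        lie_deriv x (ip g y z) = ip g (D x y) z + ip g y (D x z))"

definition torsion :: "'a connection \<Rightarrow> 'a vfield \<Rightarrow> 'a vfield \<Rightarrow> 'a vfield" where
  "torsion D x y = D x y - D y x - lie_bracket x y"

definition curvature :: "'a connection \<Rightarrow> 'a vfield \<Rightarrow> 'a vfield \<Rightarrow> 'a vfield \<Rightarrow> 'a vfield" where
  "curvature D x y z = D x (D y z) - D y (D x z) - D (lie_bracket x y) z"

text \<open>The covariant derivative \<open>(D\<^sub>x P) y\<close> of a \<open>(1,1)\<close>-tensor field \<open>P\<close>.\<close>

definition cov_deriv ::
    "'a connection \<Rightarrow> ('a \<Rightarrow> 'a tvec \<Rightarrow> 'a tvec) \<Rightarrow> 'a vfield \<Rightarrow> 'a vfield \<Rightarrow> 'a vfield" where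
  "cov_deriv D P x y = D x (app P y) - app P (D x y)"

text \<open>\<open>(D\<^sub>z T)(x, y) = 0\<close> for the torsion \<open>T\<close> of \<open>D\<close>.\<close>

definition parallel_torsion ::
    "('a, 'e::euclidean_space) chart set \<Rightarrow> 'a connection \<Rightarrow> bool" where
  "parallel_torsion A D \<longleftrightarrow>
     (\<forall>x\<in>vector_fields A. \<forall>y\<in>vector_fields A. \<forall>z\<in>vector_fields A.
        D z (torsion D x y) - torsion D (D z x) y - torsion D x (D z y) = 0)"

definition levi_civita ::
    "('a, 'e::euclidean_space) chart set \<Rightarrow> 'a metric \<Rightarrow> 'a connection \<Rightarrow> bool" where
  "levi_civita A g D \<longleftrightarrow>
     linear_connection A D \<and> metric_connection A g D \<and>
     (\<forall>x\<in>vector_fields A. \<forall>y\<in>vector_fields A. torsion D x y = 0)"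

text \<open>Here \<open>D\<close> is to be the Levi-Civita connection of \<open>g\<close>.\<close>

definition F_tensor :: "('a \<Rightarrow> 'a tvec \<Rightarrow> 'a tvec) \<Rightarrow> 'a metric \<Rightarrow> 'a connection \<Rightarrow>
    'a vfield \<Rightarrow> 'a vfield \<Rightarrow> 'a vfield \<Rightarrow> 'a \<Rightarrow> real" where
  "F_tensor P g D x y z = ip g (cov_deriv D P x y) z"

definition W3_manifold ::
    "('a::{t2_space,second_countable_topology}, 'e::euclidean_space) chart set \<Rightarrow>
     ('a \<Rightarrow> 'a tvec \<Rightarrow> 'a tvec) \<Rightarrow> 'a metric \<Rightarrow> 'a connection \<Rightarrow> bool" where
  "W3_manifold A P g D \<longleftrightarrow>
     riemannian_almost_product_manifold A P g \<and> levi_civita A g D \<and>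
     (\<forall>x\<in>vector_fields A. \<forall>y\<in>vector_fields A. \<forall>z\<in>vector_fields A.
        F_tensor P g D x y z + F_tensor P g D y z x + F_tensor P g D z x y = 0)"

definition natural_connection ::
    "('a, 'e::euclidean_space) chart set \<Rightarrow> ('a \<Rightarrow> 'a tvec \<Rightarrow> 'a tvec) \<Rightarrow> 'a metric \<Rightarrow>
     'a connection \<Rightarrow> bool" where
  "natural_connection A P g D \<longleftrightarrow>
     linear_connection A D \<and>
     (\<forall>x\<in>vector_fields A. \<forall>y\<in>vector_fields A. cov_deriv D P x y = 0) \<and>
     metric_connection A g D"

definition canonical_connection ::
    "('a, 'e::euclidean_space) chart set \<Rightarrow> ('a \<Rightarrow> 'a tvec \<Rightarrow> 'a tvec) \<Rightarrow> 'a metric \<Rightarrow>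
     'a connection \<Rightarrow> bool" where
  "canonical_connection A P g D \<longleftrightarrow>
     natural_connection A P g D \<and>
     (\<forall>x\<in>vector_fields A. \<forall>y\<in>vector_fields A. \<forall>z\<in>vector_fields A.
        ip g (torsion D x y) z + ip g (torsion D y z) x +
        ip g (torsion D (app P x) y) (app P z) +
        ip g (torsion D y (app P z)) (app P x) = 0)"

end

theory Submission
  imports Defs
begin

text \<open>
  Two independent facts make up the formula.

  The first concerns any metric connection \<open>D'\<close> with parallel torsion \<open>T\<close>, compared with the
  Levi-Civita connection \<open>D\<close> through \<open>Q = D' - D\<close>. The torsion determines \<open>Q\<close> by the Koszul-type
  formula \<open>2 g(Q(x,y),z) = T(x,y,z) - T(y,z,x) + T(z,x,y)\<close>; since \<open>g\<close> is parallel as well, so is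
  \<open>Q\<close>. Substituting \<open>D = D' - Q\<close> in the curvature of \<open>D\<close>, no derivative of \<open>Q\<close> survives and
  \<open>R'(x,y)z = R(x,y)z - Q(x,Q(y,z)) + Q(y,Q(x,z)) + Q(T(x,y),z)\<close>. As \<open>Q(x,\<cdot>)\<close> is skew, pairing with
  \<open>w\<close> produces the first two quadratic terms of the formula, and \<open>g(Q(T(x,y),z),w)\<close> is left over
  (lemma \<open>curvature_parallel_torsion\<close>).

  The second is an algebraic identity at each point, which is then applied with \<open>u = T(x,y)\<close>:
  \<open>g(Q(u,z),w) = g(Q(z,w),u) - g((D\<^sub>P\<^sub>w P)z,u)\<close> (lemma \<open>Q_rotate\<close>). Because \<open>D'P = 0\<close>, the tensor
  \<open>F\<close> is \<open>F(x,y,z) = g(Q(x,y),Pz) - g(Q(x,Py),z)\<close>, so the \<open>\<W>\<^sub>3\<close> condition and the condition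
  that defines the canonical connection are both linear in \<open>Q\<close>. Together they force
  \<open>Q(x,Py) = - Q(y,Px)\<close> (lemma \<open>canonical_W3_swap\<close>), and one more use of the \<open>\<W>\<^sub>3\<close> condition
  turns this symmetry into the identity.
\<close>

section \<open>Linear combinations of smooth functions and of vector fields\<close>

text \<open>
  Openness is essential: the derivatives at a point of \<open>S\<close> are unrestricted, so agreement of two
  functions on \<open>S\<close> transfers to derivatives only if \<open>S\<close> is a neighbourhood of the point.
\<close>

lemma Ck_on_cong:
  assumes "open S" "\<And>x. x \<in> S \<Longrightarrow> f x = h x" "Ck_on k S f"
  shows "Ck_on k S h"
  using assms(2,3)
proof (induction k arbitrary: f h)
  case 0
  then show ?case by (metis Ck_on.simps(1) continuous_on_cong)
next
  case (Suc k)
  have D: "(h has_derivative frechet_derivative f (at x)) (at x)" if "x \<in> S" for x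
  proof (rule has_derivative_transform_within_open[OF _ \<open>open S\<close> that])
    show "(f has_derivative frechet_derivative f (at x)) (at x)"
      using Suc.prems(2) that by (simp flip: frechet_derivative_works)
  qed (use Suc.prems(1) in auto)
  have eq: "frechet_derivative f (at x) = frechet_derivative h (at x)" if "x \<in> S" for x
    using frechet_derivative_at[OF D[OF that]] .
  have "h differentiable (at x)" if "x \<in> S" for x
    using D[OF that] by (auto simp: differentiable_def)
  moreover have "Ck_on k S (\<lambda>x. frechet_derivative h (at x) v)" for v
    by (rule Suc.IH[of "\<lambda>x. frechet_derivative f (at x) v"]) (use eq Suc.prems in auto)
  ultimately show ?case by simp
qed

lemma Ck_on_lincomb:
  assumes "open S" "Ck_on k S f" "Ck_on k S h"
  shows "Ck_on k S (\<lambda>x. a *\<^sub>R f x + b *\<^sub>R h x)"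
  using assms(2,3)
proof (induction k arbitrary: f h)
  case 0
  then show ?case by (auto intro!: continuous_intros)
next
  case (Suc k)
  let ?s = "\<lambda>x. a *\<^sub>R f x + b *\<^sub>R h x"
  have D: "(?s has_derivative (\<lambda>v. a *\<^sub>R frechet_derivative f (at x) v
      + b *\<^sub>R frechet_derivative h (at x) v)) (at x)" if "x \<in> S" for x
    using Suc.prems that
    by (intro has_derivative_add has_derivative_scaleR_right)
      (auto simp: frechet_derivative_works)
  have eq: "a *\<^sub>R frechet_derivative f (at x) v + b *\<^sub>R frechet_derivative h (at x) v
      = frechet_derivative ?s (at x) v" if "x \<in> S" for x v
    using fun_cong[OF frechet_derivative_at[OF D[OF that]], of v] .
  have "?s differentiable (at x)" if "x \<in> S" for x
    using D[OF that] by (auto simp: differentiable_def)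
  moreover have "Ck_on k S (\<lambda>x. frechet_derivative ?s (at x) v)" for v
    by (rule Ck_on_cong[OF \<open>open S\<close> eq]) (use Suc in auto)
  ultimately show ?case by simp
qed

lemma smooth_funs_lincomb:
  assumes "smooth_atlas A" "f \<in> smooth_funs A" "h \<in> smooth_funs A"
  shows "a *\<^sub>R f + b *\<^sub>R h \<in> smooth_funs A"
proof -
  have "Cinf_on (\<phi> ` U) ((a *\<^sub>R f + b *\<^sub>R h) \<circ> inv_into U \<phi>)" if "(U, \<phi>) \<in> A" for U \<phi>
  proof -
    have "open (\<phi> ` U)" using assms(1) that unfolding smooth_atlas_def by fast
    moreover have "Cinf_on (\<phi> ` U) (f \<circ> inv_into U \<phi>)" "Cinf_on (\<phi> ` U) (h \<circ> inv_into U \<phi>)"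
      using assms(2,3) that unfolding smooth_funs_def by fast+
    ultimately show ?thesis
      unfolding Cinf_on_def
      using Ck_on_lincomb[of "\<phi> ` U" _ "f \<circ> inv_into U \<phi>" "h \<circ> inv_into U \<phi>" a b]
      by (simp add: o_def scaleR_fun_def)
  qed
  then show ?thesis unfolding smooth_funs_def by fast
qed

lemma tangent_space_lincomb:
  assumes "u \<in> tangent_space A p" "v \<in> tangent_space A p"
  shows "a *\<^sub>R u + b *\<^sub>R v \<in> tangent_space A p"
  using assms unfolding tangent_space_def
  by (simp add: scaleR_fun_def algebra_simps)

lemma vector_fields_lincomb:
  assumes "smooth_atlas A" "X \<in> vector_fields A" "Y \<in> vector_fields A"
  shows "a *\<^sub>R X + b *\<^sub>R Y \<in> vector_fields A"
proof -
  have eq: "(a *\<^sub>R X + b *\<^sub>R Y) p = a *\<^sub>R X p + b *\<^sub>R Y p" for p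
    by (simp add: scaleR_fun_def)
  have "lie_deriv (a *\<^sub>R X + b *\<^sub>R Y) f = a *\<^sub>R lie_deriv X f + b *\<^sub>R lie_deriv Y f" for f
    by (simp add: lie_deriv_def fun_eq_iff scaleR_fun_def)
  then show ?thesis
    using assms smooth_funs_lincomb[OF assms(1)]
    unfolding vector_fields_def mem_Collect_eq eq by (simp add: tangent_space_lincomb)
qed

lemma vector_fields_add:
  "smooth_atlas A \<Longrightarrow> X \<in> vector_fields A \<Longrightarrow> Y \<in> vector_fields A \<Longrightarrow> X + Y \<in> vector_fields A"
  using vector_fields_lincomb[of A X Y 1 1] by simp

lemma vector_fields_diff:
  "smooth_atlas A \<Longrightarrow> X \<in> vector_fields A \<Longrightarrow> Y \<in> vector_fields A \<Longrightarrow> X - Y \<in> vector_fields A"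
  using vector_fields_lincomb[of A X Y 1 "- 1"] by simp

lemma smooth_funs_diff:
  "smooth_atlas A \<Longrightarrow> f \<in> smooth_funs A \<Longrightarrow> h \<in> smooth_funs A \<Longrightarrow> f - h \<in> smooth_funs A"
  using smooth_funs_lincomb[of A f h 1 "- 1"] by simp

lemma lie_deriv_add:
  assumes "X \<in> vector_fields A" "f \<in> smooth_funs A" "h \<in> smooth_funs A"
  shows "lie_deriv X (f + h) = lie_deriv X f + lie_deriv X h"
  using assms unfolding lie_deriv_def vector_fields_def tangent_space_def
  by (auto simp: fun_eq_iff)

lemma lie_deriv_diff:
  assumes "smooth_atlas A" "X \<in> vector_fields A" "f \<in> smooth_funs A" "h \<in> smooth_funs A"
  shows "lie_deriv X (f - h) = lie_deriv X f - lie_deriv X h"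
  using lie_deriv_add[OF assms(2) smooth_funs_diff[OF assms(1,3,4)] assms(4)]
  by (simp add: algebra_simps)

lemma ip_add_left:
  assumes "riemannian_metric A g" "X \<in> vector_fields A" "Y \<in> vector_fields A" "Z \<in> vector_fields A"
  shows "ip g (X + Y) Z = ip g X Z + ip g Y Z"
  using assms unfolding ip_def riemannian_metric_def vector_fields_def
  by (auto simp: fun_eq_iff)

lemma ip_commute:
  assumes "riemannian_metric A g" "X \<in> vector_fields A" "Y \<in> vector_fields A"
  shows "ip g X Y = ip g Y X"
  using assms unfolding ip_def riemannian_metric_def vector_fields_def
  by (auto simp: fun_eq_iff)

lemma ip_smooth:
  "riemannian_metric A g \<Longrightarrow> X \<in> vector_fields A \<Longrightarrow> Y \<in> vector_fields A \<Longrightarrow> ip g X Y \<in> smooth_funs A"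
  unfolding riemannian_metric_def by blast

lemma linear_connection_diff:
  assumes "smooth_atlas A" "linear_connection A D"
    and "x \<in> vector_fields A" "y \<in> vector_fields A" "z \<in> vector_fields A"
  shows "D (x - y) z = D x z - D y z" "D z (x - y) = D z x - D z y"
proof -
  have "D (x - y + y) z = D (x - y) z + D y z" "D z (x - y + y) = D z (x - y) + D z y"
    using assms vector_fields_diff[of A x y] unfolding linear_connection_def by blast+
  then show "D (x - y) z = D x z - D y z" "D z (x - y) = D z x - D z y"
    by (simp_all add: eq_diff_eq)
qed

lemma app_add:
  assumes "tensor_field_11 A P" "X \<in> vector_fields A" "Y \<in> vector_fields A"
  shows "app P (X + Y) = app P X + app P Y"
proof
  fix p
  have "X p \<in> tangent_space A p" "Y p \<in> tangent_space A p"
    using assms(2,3) unfolding vector_fields_def by auto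
  then show "app P (X + Y) p = (app P X + app P Y) p"
    using assms(1) unfolding tensor_field_11_def app_def plus_fun_apply by blast
qed

section \<open>Metric connections with parallel torsion\<close>

locale metric_connection_pair =
  fixes A :: "('a::{t2_space,second_countable_topology}, 'e::euclidean_space) chart set"
    and g :: "'a metric"
    and D D' :: "'a connection"
  assumes atlas: "smooth_atlas A"
    and metric: "riemannian_metric A g"
    and LC: "levi_civita A g D"
    and linear': "linear_connection A D'"
    and metric': "metric_connection A g D'"
begin

abbreviation "VF \<equiv> vector_fields A"

definition Q where "Q x y = D' x y - D x y"

abbreviation "T \<equiv> torsion D'"

lemma linear: "linear_connection A D"
  and metric_D: "metric_connection A g D"
  and torsion_free: "x \<in> VF \<Longrightarrow> y \<in> VF \<Longrightarrow> torsion D x y = 0"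
  using LC unfolding levi_civita_def by auto

lemma D_closed [simp]: "x \<in> VF \<Longrightarrow> y \<in> VF \<Longrightarrow> D x y \<in> VF"
  and D'_closed [simp]: "x \<in> VF \<Longrightarrow> y \<in> VF \<Longrightarrow> D' x y \<in> VF"
  using linear linear' unfolding linear_connection_def by blast+

lemma add_closed [simp]: "x \<in> VF \<Longrightarrow> y \<in> VF \<Longrightarrow> x + y \<in> VF"
  and diff_closed [simp]: "x \<in> VF \<Longrightarrow> y \<in> VF \<Longrightarrow> x - y \<in> VF"
  using vector_fields_add[OF atlas] vector_fields_diff[OF atlas] by blast+

text \<open>
  Torsion-freeness of \<open>D\<close> expresses the bracket by vector fields already at hand, which shows
  that it is a vector field without a computation with products of functions.
\<close>

lemma bracket_eq: "x \<in> VF \<Longrightarrow> y \<in> VF \<Longrightarrow> lie_bracket x y = D x y - D y x"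
  using torsion_free[of x y] by (simp add: torsion_def)

lemma bracket_closed [simp]: "x \<in> VF \<Longrightarrow> y \<in> VF \<Longrightarrow> lie_bracket x y \<in> VF"
  by (simp add: bracket_eq)

lemma Q_closed [simp]: "x \<in> VF \<Longrightarrow> y \<in> VF \<Longrightarrow> Q x y \<in> VF"
  by (simp add: Q_def)

lemma T_closed [simp]: "x \<in> VF \<Longrightarrow> y \<in> VF \<Longrightarrow> T x y \<in> VF"
  by (simp add: torsion_def)

lemma T_eq: "x \<in> VF \<Longrightarrow> y \<in> VF \<Longrightarrow> T x y = Q x y - Q y x"
  by (simp add: torsion_def bracket_eq Q_def)

lemmas D_diff = linear_connection_diff[OF atlas linear]
  and D'_diff = linear_connection_diff[OF atlas linear']

lemma Q_diff:
  assumes "x \<in> VF" "y \<in> VF" "z \<in> VF"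
  shows "Q (x - y) z = Q x z - Q y z" "Q z (x - y) = Q z x - Q z y"
  using assms by (simp_all add: Q_def D_diff D'_diff)

lemma ip_diff_left:
  assumes "x \<in> VF" "y \<in> VF" "z \<in> VF"
  shows "ip g (x - y) z = ip g x z - ip g y z"
  using ip_add_left[OF metric diff_closed[OF assms(1,2)] assms(2,3)] by (simp add: algebra_simps)

lemma Q_skew:
  assumes "x \<in> VF" "y \<in> VF" "z \<in> VF"
  shows "ip g (Q x y) z = - ip g (Q x z) y"
proof -
  have "ip g (D x y) z + ip g y (D x z) = ip g (D' x y) z + ip g y (D' x z)"
    using metric_D metric' assms unfolding metric_connection_def by metis
  then have "ip g (D' x y) z - ip g (D x y) z = - (ip g (D' x z) y - ip g (D x z) y)"
    using assms by (simp add: ip_commute[OF metric, of y] algebra_simps)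
  then show ?thesis using assms by (simp add: Q_def ip_diff_left)
qed

text \<open>
  The Koszul-type formula: expand each \<open>T(x,y) = Q(x,y) - Q(y,x)\<close> and use that \<open>Q\<close> is skew in its
  last two places. The left side is a sum rather than a multiple so that \<open>lie_deriv_add\<close> applies.
\<close>

lemma twice_Q:
  assumes "x \<in> VF" "y \<in> VF" "z \<in> VF"
  shows "ip g (Q x y) z + ip g (Q x y) z = ip g (T x y) z - ip g (T y z) x + ip g (T z x) y"
  using assms Q_skew[of x y z] Q_skew[of y z x] Q_skew[of z x y]
  by (simp add: T_eq ip_diff_left algebra_simps)

lemma lie_deriv_ip_T:
  assumes "parallel_torsion A D'" "w \<in> VF" "x \<in> VF" "y \<in> VF" "z \<in> VF"
  shows "lie_deriv w (ip g (T x y) z)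
    = ip g (T (D' w x) y) z + ip g (T x (D' w y)) z + ip g (T x y) (D' w z)"
proof -
  have "D' w (T x y) - T (D' w x) y - T x (D' w y) = 0"
    using assms unfolding parallel_torsion_def by blast
  then have "D' w (T x y) = T (D' w x) y + T x (D' w y)" by (simp add: algebra_simps)
  moreover have "lie_deriv w (ip g (T x y) z) = ip g (D' w (T x y)) z + ip g (T x y) (D' w z)"
    using metric' assms unfolding metric_connection_def by simp
  ultimately show ?thesis using assms by (simp add: ip_add_left[OF metric])
qed

text \<open>
  Differentiating \<open>twice_Q\<close> along \<open>w\<close> with the Leibniz rules of \<open>g\<close> and \<open>T\<close> leaves
  \<open>2 g((D'\<^sub>w Q)(x,y),z) = 0\<close>, once the instances of \<open>twice_Q\<close> with \<open>x\<close>, \<open>y\<close> or \<open>z\<close> replaced by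
  its derivative along \<open>w\<close> are subtracted.
\<close>

lemma Q_parallel:
  assumes par: "parallel_torsion A D'" and V: "w \<in> VF" "x \<in> VF" "y \<in> VF" "z \<in> VF"
  shows "ip g (D' w (Q x y)) z = ip g (Q (D' w x) y) z + ip g (Q x (D' w y)) z"
proof
  fix p
  have sm: "u \<in> VF \<Longrightarrow> v \<in> VF \<Longrightarrow> ip g u v \<in> smooth_funs A" for u v
    by (rule ip_smooth[OF metric])
  have Leib: "lie_deriv w (ip g (Q x y) z) = ip g (D' w (Q x y)) z + ip g (Q x y) (D' w z)"
    using metric' V unfolding metric_connection_def by simp
  have "lie_deriv w (ip g (Q x y) z) + lie_deriv w (ip g (Q x y) z)
      = lie_deriv w (ip g (Q x y) z + ip g (Q x y) z)"
    using V by (intro lie_deriv_add[OF V(1), symmetric]) (simp_all add: sm)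
  also have "\<dots> = lie_deriv w (ip g (T x y) z - ip g (T y z) x + ip g (T z x) y)"
    using twice_Q V by simp
  also have "\<dots> = lie_deriv w (ip g (T x y) z) - lie_deriv w (ip g (T y z) x)
      + lie_deriv w (ip g (T z x) y)"
    using V by (simp add: lie_deriv_add lie_deriv_diff[OF atlas] smooth_funs_diff[OF atlas] sm)
  finally have "(lie_deriv w (ip g (Q x y) z) + lie_deriv w (ip g (Q x y) z)) p
      = (lie_deriv w (ip g (T x y) z) - lie_deriv w (ip g (T y z) x)
        + lie_deriv w (ip g (T z x) y)) p"
    by (rule fun_cong)
  moreover have "(ip g (Q a b) c + ip g (Q a b) c) p
      = (ip g (T a b) c - ip g (T b c) a + ip g (T c a) b) p"
    if "a \<in> VF" "b \<in> VF" "c \<in> VF" for a b c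
    using twice_Q[OF that] by (rule fun_cong)
  note this[of x y "D' w z"] this[of "D' w x" y z] this[of x "D' w y" z]
  ultimately show "ip g (D' w (Q x y)) z p = (ip g (Q (D' w x) y) z + ip g (Q x (D' w y)) z) p"
    using V by (simp add: Leib lie_deriv_ip_T[OF par])
qed

text \<open>
  In \<open>D\<^sub>x D\<^sub>y z\<close> with \<open>D = D' - Q\<close>, parallelism replaces \<open>D'\<^sub>x (Q(y,z))\<close> by
  \<open>Q(D'\<^sub>x y,z) + Q(y,D'\<^sub>x z)\<close>. After antisymmetrizing in \<open>x\<close> and \<open>y\<close> the terms \<open>Q(y,D'\<^sub>x z)\<close>
  cancel against those from \<open>Q(x,D'\<^sub>y z)\<close>, and the terms \<open>Q(D'\<^sub>x y,z) - Q(D'\<^sub>y x,z)\<close>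
  combine with the bracket term to \<open>Q(T(x,y),z)\<close>.
\<close>

proposition curvature_parallel_torsion:
  assumes par: "parallel_torsion A D'" and V: "x \<in> VF" "y \<in> VF" "z \<in> VF" "w \<in> VF"
  shows "ip g (curvature D' x y z) w = ip g (curvature D x y z) w
    + ip g (Q y z) (Q x w) - ip g (Q x z) (Q y w) + ip g (Q (T x y) z) w"
proof
  fix p
  have DD: "D u (D v z) = D' u (D' v z) - D' u (Q v z) - Q u (D' v z) + Q u (Q v z)"
    if "u \<in> VF" "v \<in> VF" for u v
  proof -
    have *: "D a b = D' a b - Q a b" for a b by (simp add: Q_def)
    show ?thesis using that V by (simp add: * D'_diff Q_diff)
  qed
  have br: "Q (T x y) z = Q (D' x y) z - Q (D' y x) z - Q (lie_bracket x y) z"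
    using V by (simp add: torsion_def Q_diff)
  have Db: "D (lie_bracket x y) z = D' (lie_bracket x y) z - Q (lie_bracket x y) z"
    by (simp add: Q_def)
  have "curvature D x y z = (((curvature D' x y z - D' x (Q y z) - Q x (D' y z)) + Q x (Q y z))
      + D' y (Q x z) + Q y (D' x z) - Q y (Q x z)) + Q (lie_bracket x y) z"
    unfolding curvature_def DD[OF V(1,2)] DD[OF V(2,1)] Db by (simp only: algebra_simps)
  moreover have "curvature D' x y z \<in> VF" using V by (simp add: curvature_def)
  ultimately have "ip g (curvature D x y z) w = ip g (curvature D' x y z) w
      - ip g (D' x (Q y z)) w - ip g (Q x (D' y z)) w + ip g (Q x (Q y z)) w
      + ip g (D' y (Q x z)) w + ip g (Q y (D' x z)) w - ip g (Q y (Q x z)) w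
      + ip g (Q (lie_bracket x y) z) w"
    using V by (simp add: ip_diff_left ip_add_left[OF metric])
  moreover have "ip g (Q (T x y) z) w
      = ip g (Q (D' x y) z) w - ip g (Q (D' y x) z) w - ip g (Q (lie_bracket x y) z) w"
    using V by (simp add: br ip_diff_left)
  moreover have "ip g (Q x (Q y z)) w = - ip g (Q y z) (Q x w)"
    using Q_skew[of x "Q y z" w] ip_commute[OF metric, of "Q y z" "Q x w"] V by simp
  moreover have "ip g (Q y (Q x z)) w = - ip g (Q x z) (Q y w)"
    using Q_skew[of y "Q x z" w] ip_commute[OF metric, of "Q x z" "Q y w"] V by simp
  ultimately show "ip g (curvature D' x y z) w p = (ip g (curvature D x y z) w
    + ip g (Q y z) (Q x w) - ip g (Q x z) (Q y w) + ip g (Q (T x y) z) w) p"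
    using V by (simp add: Q_parallel[OF par])
qed

end

section \<open>The canonical connection of a \<open>\<W>\<^sub>3\<close>-manifold\<close>

text \<open>
  Here \<open>q(x,y,z)\<close> stands for \<open>g(Q(x,y),z)\<close>, so the symmetry can be tested on eigenvectors of \<open>P\<close>.
  When \<open>x\<close> and \<open>z\<close> belong to the same eigenvalue, the canonical condition says
  \<open>q(x,y,z) + q(z,x,y) + 2 q(y,z,x) = 0\<close>.
  If \<open>y\<close> belongs to it too, summing cyclically shows that the cyclic sum of \<open>q\<close> vanishes, hence
  \<open>q(x,y,z) = 0\<close>. If \<open>y\<close> belongs to the other eigenvalue, the \<open>\<W>\<^sub>3\<close> condition reduces to
  \<open>q(z,x,y) = q(x,y,z)\<close>, so that \<open>q(y,z,x) = - q(x,y,z)\<close>. By skewness in the last two places,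
  \<open>q(x,y,z)\<close> is thus antisymmetric in \<open>x, y\<close> when these share their eigenvalue, and symmetric when
  they do not: this is the claim \<open>q(x,Py,z) = - q(y,Px,z)\<close>. Splitting
  each vector into its eigencomponents is replaced below by an equivalent elimination: eight times
  the claim is an integer combination of instances of the two conditions at \<open>x\<close>, \<open>y\<close>, \<open>z\<close> and
  their images under \<open>P\<close>.
\<close>

lemma canonical_W3_swap:
  fixes q :: "'v \<Rightarrow> 'v \<Rightarrow> 'v \<Rightarrow> real"
  assumes P: "\<And>x. x \<in> V \<Longrightarrow> P x \<in> V" "\<And>x. x \<in> V \<Longrightarrow> P (P x) = x"
    and skew: "\<And>x y z. x \<in> V \<Longrightarrow> y \<in> V \<Longrightarrow> z \<in> V \<Longrightarrow> q x z y = - q x y z"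
    and W3: "\<And>x y z. x \<in> V \<Longrightarrow> y \<in> V \<Longrightarrow> z \<in> V \<Longrightarrow>
      q x y (P z) - q x (P y) z + (q y z (P x) - q y (P z) x) + (q z x (P y) - q z (P x) y) = 0"
    and can: "\<And>x y z. x \<in> V \<Longrightarrow> y \<in> V \<Longrightarrow> z \<in> V \<Longrightarrow>
      (q x y z - q y x z) + (q y z x - q z y x)
      + (q (P x) y (P z) - q y (P x) (P z)) + (q y (P z) (P x) - q (P z) y (P x)) = 0"
    and V: "x \<in> V" "y \<in> V" "z \<in> V"
  shows "q x (P y) z = - q y (P x) z"
proof -
  have W: "q a b (P c) - q a (P b) c + (q b c (P a) - q b (P c) a) + (q c a (P b) - q c (P a) b) = 0"
    if "a \<in> V" "b \<in> V" "c \<in> V" for a b c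
    using W3 that by blast
  \<comment> \<open>the canonical condition with all terms brought to the cyclic order of \<open>a, b, c\<close> by skewness\<close>
  have C: "q a b c + q c a b + 2 * q b c a + q (P a) b (P c) + q (P c) (P a) b + 2 * q b (P c) (P a) = 0"
    if "a \<in> V" "b \<in> V" "c \<in> V" for a b c
    using can[of a b c] skew[of b c a] skew[of c a b] skew[of b "P c" "P a"] skew[of "P c" "P a" b]
      that P(1) by simp
  note V' = V P(1)[OF V(1)] P(1)[OF V(2)] P(1)[OF V(3)]
  note PP = P(2)[OF V(1)] P(2)[OF V(2)] P(2)[OF V(3)]
  \<comment> \<open>The six equations that follow, with coefficients \<open>3, 1, -1, -3, 1, 3\<close>, add up to
      \<open>8 q(y,z,Px) - 8 q(x,Py,z) = 0\<close>.\<close>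
  have "q x y (P z) - q x (P y) z + (q y z (P x) - q y (P z) x) + (q z x (P y) - q z (P x) y) = 0"
    using W V by blast
  moreover have "q (P x) (P y) (P z) - q (P x) y z + (q (P y) z x - q (P y) (P z) (P x))
      + (q z (P x) y - q z x (P y)) = 0"
    using W[of "P x" "P y" z] V' PP by simp
  moreover have "q (P z) (P x) (P y) + q (P y) (P z) (P x) + 2 * q (P x) (P y) (P z)
      + q z (P x) y + q y z (P x) + 2 * q (P x) y z = 0"
    using C[of "P z" "P x" "P y"] V' PP by simp
  moreover have "q z x (P y) + q (P y) z x + 2 * q x (P y) z
      + q (P z) x y + q y (P z) x + 2 * q x y (P z) = 0"
    using C[of z x "P y"] V' PP by simp
  moreover have "q x (P y) z + q z x (P y) + 2 * q (P y) z x
      + q (P x) (P y) (P z) + q (P z) (P x) (P y) + 2 * q (P y) (P z) (P x) = 0"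
    using C[of x "P y" z] V' PP by simp
  moreover have "q (P x) y z + q z (P x) y + 2 * q y z (P x)
      + q x y (P z) + q (P z) x y + 2 * q y (P z) x = 0"
    using C[of "P x" y z] V' PP by simp
  ultimately have "q x (P y) z = q y z (P x)" by linarith
  then show ?thesis using skew[of y "P x" z] V' by simp
qed

text \<open>
  The \<open>\<W>\<^sub>3\<close> condition at \<open>Pw, u, z\<close> already is the claim, up to the two terms \<open>- q(u,Pz,Pw)\<close> and
  \<open>q(z,Pw,Pu)\<close>; these cancel by \<open>canonical_W3_swap\<close>.
\<close>

lemma canonical_W3_rotate:
  fixes q :: "'v \<Rightarrow> 'v \<Rightarrow> 'v \<Rightarrow> real"
  assumes P: "\<And>x. x \<in> V \<Longrightarrow> P x \<in> V" "\<And>x. x \<in> V \<Longrightarrow> P (P x) = x"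
    and skew: "\<And>x y z. x \<in> V \<Longrightarrow> y \<in> V \<Longrightarrow> z \<in> V \<Longrightarrow> q x z y = - q x y z"
    and W3: "\<And>x y z. x \<in> V \<Longrightarrow> y \<in> V \<Longrightarrow> z \<in> V \<Longrightarrow>
      q x y (P z) - q x (P y) z + (q y z (P x) - q y (P z) x) + (q z x (P y) - q z (P x) y) = 0"
    and can: "\<And>x y z. x \<in> V \<Longrightarrow> y \<in> V \<Longrightarrow> z \<in> V \<Longrightarrow>
      (q x y z - q y x z) + (q y z x - q z y x)
      + (q (P x) y (P z) - q y (P x) (P z)) + (q y (P z) (P x) - q (P z) y (P x)) = 0"
    and V: "u \<in> V" "z \<in> V" "w \<in> V"
  shows "q u z w = q z w u - (q (P w) z (P u) - q (P w) (P z) u)"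
proof -
  note V' = V P(1)[OF V(1)] P(1)[OF V(2)] P(1)[OF V(3)]
  have "q (P w) u (P z) - q (P w) (P u) z + (q u z w - q u (P z) (P w)) + (q z (P w) (P u) - q z w u) = 0"
    using W3[of "P w" u z] V' P(2)[OF V(3)] by simp
  moreover have "q u (P z) (P w) = - q z (P u) (P w)"
    by (rule canonical_W3_swap[where q = q and P = P and V = V, OF P skew W3 can]) (use V' in auto)
  moreover have "q z (P w) (P u) = - q z (P u) (P w)" "q (P w) u (P z) = - q (P w) (P z) u"
    "q (P w) (P u) z = - q (P w) z (P u)"
    using skew V' by blast+
  ultimately show ?thesis by linarith
qed

context metric_connection_pair
begin

proposition Q_rotate:
  assumes W3: "W3_manifold A P g D"
    and can: "canonical_connection A P g D'"
    and V: "u \<in> VF" "z \<in> VF" "w \<in> VF"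
  shows "ip g (Q u z) w = ip g (Q z w) u - ip g (cov_deriv D P (app P w) z) u"
proof
  fix p
  have P: "riemannian_almost_product_manifold A P g"
    using W3 unfolding W3_manifold_def by blast
  have Pc: "app P x \<in> VF" and PP: "app P (app P x) = x" if "x \<in> VF" for x
    using P that unfolding riemannian_almost_product_manifold_def tensor_field_11_def by blast+
  \<comment> \<open>an isometric involution is self-adjoint\<close>
  have adj: "ip g (app P x) y = ip g x (app P y)" if "x \<in> VF" "y \<in> VF" for x y
  proof -
    have "ip g (app P x) (app P (app P y)) = ip g x (app P y)"
      using P that Pc[of y] unfolding riemannian_almost_product_manifold_def by blast
    then show ?thesis using PP[of y] that by simp
  qed
  have P_diff: "app P (x - y) = app P x - app P y" if "x \<in> VF" "y \<in> VF" for x y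
  proof -
    have "tensor_field_11 A P"
      using P unfolding riemannian_almost_product_manifold_def by blast
    from app_add[OF this diff_closed[OF that] that(2)] show ?thesis by (simp add: eq_diff_eq)
  qed
  \<comment> \<open>\<open>D'P = 0\<close> makes the covariant derivative of \<open>P\<close> the commutator of \<open>P\<close> and \<open>Q(x,\<cdot>)\<close>\<close>
  have cov: "ip g (cov_deriv D P x y) z = ip g (Q x y) (app P z) - ip g (Q x (app P y)) z"
    if "x \<in> VF" "y \<in> VF" "z \<in> VF" for x y z
  proof -
    have "D' x (app P y) - app P (D' x y) = 0"
      using can that unfolding canonical_connection_def natural_connection_def cov_deriv_def
      by blast
    then have "cov_deriv D P x y = app P (Q x y) - Q x (app P y)"
      using that Pc by (simp add: cov_deriv_def Q_def P_diff)
    then show ?thesis using that Pc by (simp add: ip_diff_left adj)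
  qed
  have W3': "ip g (Q x y) (app P z) p - ip g (Q x (app P y)) z p
      + (ip g (Q y z) (app P x) p - ip g (Q y (app P z)) x p)
      + (ip g (Q z x) (app P y) p - ip g (Q z (app P x)) y p) = 0"
    if "x \<in> VF" "y \<in> VF" "z \<in> VF" for x y z
  proof -
    have "F_tensor P g D x y z + F_tensor P g D y z x + F_tensor P g D z x y = 0"
      using W3 that unfolding W3_manifold_def by blast
    from fun_cong[OF this, of p] show ?thesis using that by (simp add: F_tensor_def cov)
  qed
  have can': "(ip g (Q x y) z p - ip g (Q y x) z p) + (ip g (Q y z) x p - ip g (Q z y) x p)
      + (ip g (Q (app P x) y) (app P z) p - ip g (Q y (app P x)) (app P z) p)
      + (ip g (Q y (app P z)) (app P x) p - ip g (Q (app P z) y) (app P x) p) = 0"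
    if "x \<in> VF" "y \<in> VF" "z \<in> VF" for x y z
  proof -
    have "ip g (T x y) z + ip g (T y z) x + ip g (T (app P x) y) (app P z)
        + ip g (T y (app P z)) (app P x) = 0"
      using can that unfolding canonical_connection_def by blast
    from fun_cong[OF this, of p] show ?thesis using that Pc by (simp add: T_eq ip_diff_left)
  qed
  have skew: "ip g (Q x z) y p = - ip g (Q x y) z p" if "x \<in> VF" "y \<in> VF" "z \<in> VF" for x y z
    using Q_skew[OF that(1,3,2), THEN fun_cong, of p] by simp
  have "ip g (Q u z) w p = ip g (Q z w) u p
      - (ip g (Q (app P w) z) (app P u) p - ip g (Q (app P w) (app P z)) u p)"
    by (rule canonical_W3_rotate[where q = "\<lambda>x y z. ip g (Q x y) z p" and V = VF
        and P = "app P", OF Pc PP skew W3' can' V])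
  then show "ip g (Q u z) w p = (ip g (Q z w) u - ip g (cov_deriv D P (app P w) z) u) p"
    using V Pc by (simp add: cov)
qed

end

theorem proposition6p3:
  fixes A :: "('a::{t2_space,second_countable_topology}, 'e::euclidean_space) chart set"
    and P :: "'a \<Rightarrow> 'a tvec \<Rightarrow> 'a tvec"
    and g :: "'a metric"
    and nabla nabla' :: "'a connection"
    and Q T :: "'a vfield \<Rightarrow> 'a vfield \<Rightarrow> 'a vfield"
    and R R' :: "'a vfield \<Rightarrow> 'a vfield \<Rightarrow> 'a vfield \<Rightarrow> 'a vfield \<Rightarrow> 'a \<Rightarrow> real"
  assumes "levi_civita A g nabla"
    and "W3_manifold A P g nabla"
    and "canonical_connection A P g nabla'"
    and "parallel_torsion A nabla'"
    and "\<And>x y. T x y = torsion nabla' x y"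
    and "\<And>x y. Q x y = nabla' x y - nabla x y"
    and "\<And>x y z w. R x y z w = ip g (curvature nabla x y z) w"
    and "\<And>x y z w. R' x y z w = ip g (curvature nabla' x y z) w"
  shows "\<forall>x\<in>vector_fields A. \<forall>y\<in>vector_fields A. \<forall>z\<in>vector_fields A. \<forall>w\<in>vector_fields A.
    R' x y z w = R x y z w
      + ip g (Q y z) (Q x w) - ip g (Q x z) (Q y w)
      + ip g (Q z w) (T x y) - ip g (cov_deriv nabla P (app P w) z) (T x y)"
proof -
  have P: "riemannian_almost_product_manifold A P g"
    using assms(2) unfolding W3_manifold_def by blast
  interpret M: metric_connection_pair A g nabla nabla'
    using P assms(1,3)
    unfolding metric_connection_pair_def riemannian_almost_product_manifold_def
      canonical_connection_def natural_connection_def by blast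
  have Q: "Q = M.Q" by (intro ext) (simp add: assms(6) M.Q_def)
  show ?thesis
  proof (intro ballI)
    fix x y z w
    assume V: "x \<in> vector_fields A" "y \<in> vector_fields A" "z \<in> vector_fields A" "w \<in> vector_fields A"
    have "ip g (Q (T x y) z) w = ip g (Q z w) (T x y) - ip g (cov_deriv nabla P (app P w) z) (T x y)"
      unfolding Q assms(5) using V by (intro M.Q_rotate[OF assms(2,3)]) simp_all
    moreover have "R' x y z w = R x y z w + ip g (Q y z) (Q x w) - ip g (Q x z) (Q y w)
        + ip g (Q (T x y) z) w"
      unfolding Q assms(5,7,8) by (rule M.curvature_parallel_torsion[OF assms(4) V])
    ultimately show "R' x y z w = R x y z w + ip g (Q y z) (Q x w) - ip g (Q x z) (Q y w)
        + ip g (Q z w) (T x y) - ip g (cov_deriv nabla P (app P w) z) (T x y)"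
      by (simp only: add_diff_eq)
  qed
qed

end
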